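(* Let $c\ge 0$ be a constant. Let $h(z)=z+\sum_{n=2}^{\infty}a_nz^n$ and $g(z)=\sum_{n=1}^{\infty}b_nz^n$ be analytic in $\mathbb{D}$ with $|b_1|=|g'(0)|<1$, and suppose that $$|a_n|+|b_n|\le c\qquad\text{for all } n\ge 2.$$ Then $f=h+\overline{g}$ is close-to-convex (in particular univalent), and starlike, in the disk $|z|<r_S$, where $$r_S=1-\sqrt{\frac{c}{c+1-|b_1|}}.$$ The result is sharp: for given $c$ and given value of $|b_1|\in[0,1)$, $r_S$ cannot be replaced by any larger number, i.e. for every $r\in(r_S,1]$ there are $h,g$ satisfying the hypotheses (with these $c$ and $|b_1|$) for which $f=h+\overline{g}$ is not univalent in $|z|<r$.
   Context: $\mathbb{D}=\{z\in\mathbb{C}:|z|<1\}$. A domain $\Omega\subset\mathbb{C}$ is close-to-convex if its complement $\mathbb{C}\setminus\Omega$ is a union of closed half-lines whose interiors (open half-lines) are pairwise disjoint. A complex-valued harmonic function $f$ is called close-to-convex (resp. starlike) in a disk $|z|<r$ if it is univalent (injective) and sense-preserving there and maps that disk onto a close-to-convex domain (resp. onto a domain starlike with respect to the origin). *)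

theory Defs
  imports "HOL-Complex_Analysis.Complex_Analysis"
begin

definition planar_domain :: "complex set \<Rightarrow> bool" where
  "planar_domain S \<longleftrightarrow> open S \<and> connected S \<and> S \<noteq> {}"

definition closed_half_line :: "complex \<Rightarrow> complex \<Rightarrow> complex set" where
  "closed_half_line p u = {p + of_real t * u |t. t \<ge> 0}"

definition open_half_line :: "complex \<Rightarrow> complex \<Rightarrow> complex set" where
  "open_half_line p u = {p + of_real t * u |t. t > 0}"

(* A family of half-lines is represented by the set L of pairs (endpoint, direction).
   Directions are unit vectors, so distinct pairs are distinct half-lines and
   pairwise disjointness over L is pairwise disjointness of the half-lines. *)
definition close_to_convex_domain :: "complex set \<Rightarrow> bool" where
  "close_to_convex_domain S \<longleftrightarrow> planar_domain S \<and>
     (\<exists>L. (\<forall>(p, u) \<in> L. norm u = 1) \<and>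
          - S = (\<Union>(p, u) \<in> L. closed_half_line p u) \<and>
          disjoint_family_on (\<lambda>(p, u). open_half_line p u) L)"

(* The library predicate starlike leaves the centre existentially quantified. *)
definition starlike_domain :: "complex set \<Rightarrow> bool" where
  "starlike_domain S \<longleftrightarrow> planar_domain S \<and> 0 \<in> S \<and> (\<forall>w \<in> S. closed_segment 0 w \<subseteq> S)"

(* Positive Jacobian: the inequality says that the real-linear map f' on the plane has
   positive determinant with respect to the basis 1, i.  For f = h + cnj g this
   determinant is norm (h' z)^2 - norm (g' z)^2. *)
definition sense_preserving_on :: "(complex \<Rightarrow> complex) \<Rightarrow> complex set \<Rightarrow> bool" where
  "sense_preserving_on f S \<longleftrightarrow>
     (\<forall>z \<in> S. \<exists>f'. (f has_derivative f') (at z) \<and>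
        Re (f' 1) * Im (f' \<i>) - Im (f' 1) * Re (f' \<i>) > 0)"

(* The next two predicates are meant for f harmonic in the disk |z| < r. *)
definition close_to_convex_in_disk :: "(complex \<Rightarrow> complex) \<Rightarrow> real \<Rightarrow> bool" where
  "close_to_convex_in_disk f r \<longleftrightarrow>
     inj_on f (ball 0 r) \<and> sense_preserving_on f (ball 0 r) \<and>
     close_to_convex_domain (f ` ball 0 r)"

definition starlike_in_disk :: "(complex \<Rightarrow> complex) \<Rightarrow> real \<Rightarrow> bool" where
  "starlike_in_disk f r \<longleftrightarrow>
     inj_on f (ball 0 r) \<and> sense_preserving_on f (ball 0 r) \<and>
     starlike_domain (f ` ball 0 r)"

definition coefficient_bounded ::
  "real \<Rightarrow> (complex \<Rightarrow> complex) \<Rightarrow> (complex \<Rightarrow> complex) \<Rightarrow>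
   (nat \<Rightarrow> complex) \<Rightarrow> (nat \<Rightarrow> complex) \<Rightarrow> bool" where
  "coefficient_bounded c h g a b \<longleftrightarrow>
     h holomorphic_on ball 0 1 \<and> g holomorphic_on ball 0 1 \<and>
     (\<forall>z \<in> ball 0 1. (\<lambda>n. a n * z ^ n) sums h z) \<and> a 0 = 0 \<and> a 1 = 1 \<and>
     (\<forall>z \<in> ball 0 1. (\<lambda>n. b n * z ^ n) sums g z) \<and> b 0 = 0 \<and>
     norm (b 1) < 1 \<and>
     (\<forall>n \<ge> 2. norm (a n) + norm (b n) \<le> c)"

definition r_S :: "real \<Rightarrow> real \<Rightarrow> real" where
  "r_S c \<beta> = 1 - sqrt (c / (c + 1 - \<beta>))"

end

theory Submission
  imports Defs
begin

text \<open>
  Write \<open>f = h + cnj g\<close>, \<open>\<beta> = |b\<^sub>1|\<close> and \<open>R = r_S c \<beta>\<close>.  The radius is chosen so that the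
  coefficient hypothesis gives \<open>\<Sum>\<^sub>n\<^sub>\<ge>\<^sub>2 n (|a\<^sub>n| + |b\<^sub>n|) \<rho>\<^sup>n\<^sup>-\<^sup>1 < 1 - \<beta>\<close> whenever \<open>\<rho> < R\<close>
  (\<open>derivative_majorant_sums\<close>, \<open>derivative_majorant_less\<close>); informally, the linear term of \<open>f\<close>
  dominates all the others.

  Univalence and starlikeness both come from one rigidity statement, \<open>radial_rigidity\<close>: if
  \<open>|z| \<le> |w| < R\<close>, \<open>0 \<le> \<mu> \<le> 1\<close> and \<open>f w = \<mu> f z\<close>, then \<open>w = \<mu> z\<close>.  To see this, subtract the
  power series of \<open>f w\<close> and \<open>\<mu> f z\<close> termwise.  The linear terms contribute at least
  \<open>(1 - \<beta>) |w - \<mu> z|\<close>, while \<open>|w\<^sup>n - \<mu> z\<^sup>n| \<le> n |w|\<^sup>n\<^sup>-\<^sup>1 |w - \<mu> z|\<close> (\<open>scaled_power_diff_le\<close>) bounds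
  the higher ones by a strictly smaller multiple of \<open>|w - \<mu> z|\<close>.  For \<open>\<mu> = 1\<close> this is
  injectivity.  For general \<open>\<mu>\<close> it says that shrinking a value of \<open>f\<close> towards 0 cannot increase
  the modulus of its preimage, so that preimages of points of a segment from 0 to \<open>f z\<close> stay in the
  compact disk of radius \<open>|z|\<close>.  Hence the part of the segment covered by the image is both open
  and closed in the segment (\<open>starlike_image_ball\<close>).  This replaces the usual argument, in which
  \<open>arg f\<close> is differentiated along circles.

  A starlike domain is close-to-convex for an elementary reason: its complement is the union of
  the parts of radial rays that lie outside it (\<open>starlike_imp_close_to_convex\<close>).

  For sharpness take \<open>h z = z - c z\<^sup>2 / (1 - z)\<close> and \<open>g z = - \<beta> z\<close>.  On the real axis \<open>f\<close> is then a
  real function with a fold at \<open>R\<close>, and it takes equal values at \<open>x\<close> and \<open>y\<close> as soon as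
  \<open>(1 - x) (1 - y) = (1 - R)\<^sup>2\<close>.
\<close>

section \<open>The radius and its majorant series\<close>

lemma r_S_pos:
  assumes "c \<ge> 0" "\<beta> < 1"
  shows "0 < r_S c \<beta>"
  using assms by (simp add: r_S_def real_less_lsqrt)

lemma r_S_le_1:
  assumes "c \<ge> 0" "\<beta> < 1"
  shows "r_S c \<beta> \<le> 1"
  using assms by (simp add: r_S_def)

lemma derivative_majorant_sums:
  fixes c \<rho> :: real
  assumes "0 \<le> \<rho>" "\<rho> < 1"
  shows "(\<lambda>n. c * (real (n + 2) * \<rho> ^ (n + 1))) sums (c * (1 / (1 - \<rho>)\<^sup>2 - 1))"
proof -
  have "(\<lambda>n. of_nat (Suc n) * \<rho> ^ n) sums (1 / (1 - \<rho>)\<^sup>2)"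
    using assms by (intro geometric_deriv_sums) simp
  then have "(\<lambda>n. of_nat (Suc (Suc n)) * \<rho> ^ Suc n) sums (1 / (1 - \<rho>)\<^sup>2 - 1)"
    by (subst sums_Suc_iff) simp
  then show ?thesis
    by (intro sums_mult) (simp add: algebra_simps)
qed

text \<open>
  Clearing denominators turns this inequality into \<open>c < (1 - \<rho>)\<^sup>2 (c + 1 - \<beta>)\<close>; so
  \<open>r_S c \<beta>\<close> is exactly the radius up to which the higher-order terms of the derivative stay below
  the linear one.
\<close>

lemma derivative_majorant_less:
  assumes "c \<ge> 0" "\<beta> < 1" "\<rho> < r_S c \<beta>"
  shows "c * (1 / (1 - \<rho>)\<^sup>2 - 1) < 1 - \<beta>"
proof -
  have s: "sqrt (c / (c + 1 - \<beta>)) < 1 - \<rho>"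
    using assms(3) by (simp add: r_S_def)
  have pos: "c + 1 - \<beta> > 0" "0 \<le> c / (c + 1 - \<beta>)"
    using assms(1,2) by auto
  then have "0 < 1 - \<rho>"
    using s real_sqrt_ge_zero[of "c / (c + 1 - \<beta>)"] by linarith
  then have p2: "(1 - \<rho>)\<^sup>2 > 0"
    by simp
  have "(sqrt (c / (c + 1 - \<beta>)))\<^sup>2 < (1 - \<rho>)\<^sup>2"
    using s pos by (intro power_strict_mono) auto
  then have "c / (c + 1 - \<beta>) < (1 - \<rho>)\<^sup>2"
    using pos by simp
  then have "c / (1 - \<rho>)\<^sup>2 < c + 1 - \<beta>"
    using pos(1) p2 by (simp add: field_simps)
  then show ?thesis
    by (simp add: algebra_simps)
qed

section \<open>Comparing values along a ray\<close>

text \<open>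
  Decompose \<open>w - \<mu> z = (1 - \<mu>) w + \<mu> (w - z)\<close>.  The two summands have nonnegative inner product,
  because \<open>z\<close> lies in the ball of radius \<open>|w|\<close>; hence the sum is at least as long as the second one.
\<close>

lemma scaled_dist_le:
  fixes z w :: "'a :: real_inner"
  assumes "norm z \<le> norm w" "0 \<le> \<mu>" "\<mu> \<le> 1"
  shows "\<mu> * norm (w - z) \<le> norm (w - \<mu> *\<^sub>R z)"
proof -
  have "w \<bullet> z \<le> norm w * norm w"
    using norm_cauchy_schwarz[of w z] mult_left_mono[OF assms(1), of "norm w"] by simp
  then have wz: "w \<bullet> z \<le> w \<bullet> w"
    by (simp add: dot_square_norm power2_eq_square)
  have "(norm (w - \<mu> *\<^sub>R z))\<^sup>2 - (\<mu> * norm (w - z))\<^sup>2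
      = (1 - \<mu>)\<^sup>2 * (w \<bullet> w) + 2 * (\<mu> * (1 - \<mu>)) * (w \<bullet> w - w \<bullet> z)"
    unfolding power_mult_distrib power2_norm_eq_inner
    by (simp add: inner_diff_left inner_diff_right inner_commute power2_eq_square algebra_simps)
  moreover have "\<dots> \<ge> 0"
    using wz assms by (intro add_nonneg_nonneg mult_nonneg_nonneg) auto
  ultimately have "(\<mu> * norm (w - z))\<^sup>2 \<le> (norm (w - \<mu> *\<^sub>R z))\<^sup>2"
    by linarith
  then show ?thesis
    by (rule power2_le_imp_le) simp
qed

text \<open>
  For \<open>\<mu> = 1\<close> this is the Lipschitz bound for powers.  The point of the general case is that the
  same constant serves for every \<open>\<mu>\<close>: in the induction step
  \<open>w\<^sup>n\<^sup>+\<^sup>1 - \<mu> z\<^sup>n\<^sup>+\<^sup>1 = w (w\<^sup>n - \<mu> z\<^sup>n) + z\<^sup>n \<mu> (w - z)\<close>, and the last factor is controlled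
  by \<open>scaled_dist_le\<close>.
\<close>

lemma scaled_power_diff_le:
  fixes z w :: complex
  assumes "norm z \<le> norm w" "0 \<le> \<mu>" "\<mu> \<le> 1"
  shows "norm (w ^ Suc n - of_real \<mu> * z ^ Suc n)
    \<le> real (Suc n) * norm w ^ n * norm (w - of_real \<mu> * z)"
proof (induction n)
  case 0
  then show ?case by simp
next
  case (Suc n)
  let ?d = "norm (w - of_real \<mu> * z)"
  have "w ^ Suc (Suc n) - of_real \<mu> * z ^ Suc (Suc n)
      = w * (w ^ Suc n - of_real \<mu> * z ^ Suc n) + z ^ Suc n * (of_real \<mu> * (w - z))"
    by (simp add: algebra_simps)
  then have "norm (w ^ Suc (Suc n) - of_real \<mu> * z ^ Suc (Suc n))
      \<le> norm w * norm (w ^ Suc n - of_real \<mu> * z ^ Suc n) + norm z ^ Suc n * (\<mu> * norm (w - z))"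
    using norm_triangle_ineq[of "w * (w ^ Suc n - of_real \<mu> * z ^ Suc n)" "z ^ Suc n * (of_real \<mu> * (w - z))"] assms(2)
    by (simp only: norm_mult norm_power norm_of_real abs_of_nonneg)
  also have "\<dots> \<le> norm w * (real (Suc n) * norm w ^ n * ?d) + norm w ^ Suc n * ?d"
  proof (intro add_mono mult_mono mult_nonneg_nonneg)
    show "norm z ^ Suc n \<le> norm w ^ Suc n"
      using assms(1) by (intro power_mono) auto
    show "\<mu> * norm (w - z) \<le> ?d"
      using scaled_dist_le[OF assms] by (simp add: scaleR_conv_of_real)
  qed (use Suc assms in auto)
  also have "\<dots> = real (Suc (Suc n)) * norm w ^ Suc n * ?d"
    by (simp add: algebra_simps)
  finally show ?case .
qed

text \<open>
  With \<open>d = w - \<mu> z\<close> and \<open>e\<^sub>n = w\<^sup>n - \<mu> z\<^sup>n\<close>, the hypothesis says that \<open>a\<^sub>n e\<^sub>n + cnj (b\<^sub>n e\<^sub>n)\<close> sums to 0.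
  Its linear term \<open>d + cnj (b\<^sub>1 d)\<close> is therefore balanced by the rest of the series, which is too
  small for that unless \<open>d = 0\<close>.
\<close>

lemma radial_rigidity:
  assumes cb: "coefficient_bounded c h g a b" and c: "c \<ge> 0"
    and w: "norm w < r_S c (norm (b 1))" and zw: "norm z \<le> norm w"
    and l: "0 \<le> \<mu>" "\<mu> \<le> 1"
    and eq: "h w + cnj (g w) = of_real \<mu> * (h z + cnj (g z))"
  shows "w = of_real \<mu> * z"
proof (rule ccontr)
  let ?\<beta> = "norm (b 1)" and ?\<rho> = "norm w"
  define d where "d = w - of_real \<mu> * z"
  assume "w \<noteq> of_real \<mu> * z"
  then have d: "norm d > 0"
    by (simp add: d_def)
  have b1: "?\<beta> < 1" and a01: "a 0 = 0" "a 1 = 1" "b 0 = 0"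
    and bd: "\<And>n. n \<ge> 2 \<Longrightarrow> norm (a n) + norm (b n) \<le> c"
    using cb by (auto simp: coefficient_bounded_def)
  have w1: "norm w < 1" "norm z < 1"
    using w zw r_S_le_1[OF c b1] by auto
  then have h: "(\<lambda>n. a n * w ^ n) sums h w" "(\<lambda>n. a n * z ^ n) sums h z"
    and g: "(\<lambda>n. b n * w ^ n) sums g w" "(\<lambda>n. b n * z ^ n) sums g z"
    using cb by (auto simp: coefficient_bounded_def)
  define e where "e n = w ^ n - of_real \<mu> * z ^ n" for n
  define u where "u n = a n * e n + cnj (b n * e n)" for n
  have "(\<lambda>n. a n * w ^ n - of_real \<mu> * (a n * z ^ n)) sums (h w - of_real \<mu> * h z)"
    by (intro sums_diff sums_mult h)
  then have su_h: "(\<lambda>n. a n * e n) sums (h w - of_real \<mu> * h z)"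
    by (simp add: e_def algebra_simps)
  have "(\<lambda>n. b n * w ^ n - of_real \<mu> * (b n * z ^ n)) sums (g w - of_real \<mu> * g z)"
    by (intro sums_diff sums_mult g)
  then have "(\<lambda>n. b n * e n) sums (g w - of_real \<mu> * g z)"
    by (simp add: e_def algebra_simps)
  then have "u sums (h w - of_real \<mu> * h z + cnj (g w - of_real \<mu> * g z))"
    unfolding u_def using su_h by (intro sums_add) (simp_all only: sums_cnj)
  moreover have "h w - of_real \<mu> * h z + cnj (g w - of_real \<mu> * g z) = 0"
    using eq by (simp add: algebra_simps)
  ultimately have "u sums 0"
    by simp
  then have "(\<lambda>n. u (n + 2)) sums (0 - (\<Sum>i<2. u i))"
    by (rule sums_split_initial_segment)
  moreover have "(\<Sum>i<2. u i) = d + cnj (b 1 * d)"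
    using a01 by (simp add: u_def e_def d_def numeral_2_eq_2)
  ultimately have tail: "(\<lambda>n. u (n + 2)) sums (- (d + cnj (b 1 * d)))"
    by simp
  have "norm (- (d + cnj (b 1 * d))) \<le> c * (1 / (1 - ?\<rho>)\<^sup>2 - 1) * norm d"
  proof (rule norm_sums_le[OF tail])
    show "(\<lambda>n. c * (real (n + 2) * ?\<rho> ^ (n + 1)) * norm d)
        sums (c * (1 / (1 - ?\<rho>)\<^sup>2 - 1) * norm d)"
      using w1 by (intro sums_mult2 derivative_majorant_sums) auto
  next
    fix n
    have "norm (u (n + 2)) \<le> norm (a (n + 2)) * norm (e (n + 2)) + norm (b (n + 2)) * norm (e (n + 2))"
      unfolding u_def by (metis norm_triangle_ineq norm_mult complex_mod_cnj)
    also have "\<dots> = (norm (a (n + 2)) + norm (b (n + 2))) * norm (e (n + 2))"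
      by (simp add: algebra_simps)
    also have "\<dots> \<le> c * (real (n + 2) * ?\<rho> ^ (n + 1) * norm d)"
      using bd[of "n + 2"] scaled_power_diff_le[OF zw l, of "n + 1"] c
      by (intro mult_mono) (auto simp: e_def d_def)
    finally show "norm (u (n + 2)) \<le> c * (real (n + 2) * ?\<rho> ^ (n + 1)) * norm d"
      by (simp add: algebra_simps)
  qed
  moreover have "norm (- (d + cnj (b 1 * d))) \<ge> (1 - ?\<beta>) * norm d"
    using norm_diff_ineq[of d "cnj (b 1 * d)"]
    by (simp only: norm_minus_cancel complex_mod_cnj norm_mult) (simp add: algebra_simps)
  ultimately have "(1 - ?\<beta>) * norm d \<le> c * (1 / (1 - ?\<rho>)\<^sup>2 - 1) * norm d"
    by linarith
  with d derivative_majorant_less[OF c b1 w] show False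
    by simp
qed

section \<open>The Jacobian\<close>

text \<open>
  If \<open>|h'| \<le> |g'|\<close>, then the single analytic function \<open>h + \<eta> g\<close> has a critical point at \<open>z\<close> for
  some constant \<open>|\<eta>| \<le> 1\<close>.  Its derivative starts with \<open>1 + \<eta> b\<^sub>1\<close>, of modulus at least \<open>1 - \<beta>\<close>,
  and the remaining terms cannot cancel this.  Working with \<open>h + \<eta> g\<close> means that \<open>|a\<^sub>n| + |b\<^sub>n|\<close>
  appears in each term, so the hypothesis on the coefficients applies directly.
\<close>

lemma analytic_part_dominates:
  assumes cb: "coefficient_bounded c h g a b" and c: "c \<ge> 0"
    and z: "norm z < r_S c (norm (b 1))"
    and h': "(h has_field_derivative h') (at z)" and g': "(g has_field_derivative g') (at z)"
  shows "norm g' < norm h'"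
proof (rule ccontr)
  let ?\<beta> = "norm (b 1)" and ?\<rho> = "norm z"
  assume "\<not> norm g' < norm h'"
  then have le: "norm h' \<le> norm g'"
    by simp
  \<comment> \<open>If \<open>g' = 0\<close>, then also \<open>h' = 0\<close>, and the quotient is 0 by convention; this value works too.\<close>
  define \<eta> where "\<eta> = - h' / g'"
  have \<eta>: "norm \<eta> \<le> 1" "h' + \<eta> * g' = 0"
    using le by (auto simp: \<eta>_def norm_divide divide_le_eq_1)
  have b1: "?\<beta> < 1" and a01: "a 1 = 1"
    and bd: "\<And>n. n \<ge> 2 \<Longrightarrow> norm (a n) + norm (b n) \<le> c"
    using cb by (auto simp: coefficient_bounded_def)
  have z1: "norm z < 1"
    using z r_S_le_1[OF c b1] by auto
  have "(\<lambda>n. diffs a n * z ^ n) sums h'" "(\<lambda>n. diffs b n * z ^ n) sums g'"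
    using cb h' g' z1
    by (auto simp: coefficient_bounded_def
        intro: termdiffs_sums_strong[where K = 1 and f = h] termdiffs_sums_strong[where K = 1 and f = g])
  then have "(\<lambda>n. diffs a n * z ^ n + \<eta> * (diffs b n * z ^ n)) sums (h' + \<eta> * g')"
    by (intro sums_add sums_mult)
  then have "(\<lambda>n. diffs a n * z ^ n + \<eta> * (diffs b n * z ^ n)) sums 0"
    by (simp add: \<eta>)
  then have "(\<lambda>n. diffs a (Suc n) * z ^ Suc n + \<eta> * (diffs b (Suc n) * z ^ Suc n))
      sums (- (1 + \<eta> * b 1))"
    by (subst sums_Suc_iff) (use a01 in \<open>simp add: diffs_def\<close>)
  then have "norm (- (1 + \<eta> * b 1)) \<le> c * (1 / (1 - ?\<rho>)\<^sup>2 - 1)"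
  proof (rule norm_sums_le[OF _ derivative_majorant_sums])
    fix n
    let ?k = "real (n + 2) * ?\<rho> ^ (n + 1)"
    have "norm (diffs a (Suc n) * z ^ Suc n + \<eta> * (diffs b (Suc n) * z ^ Suc n))
        \<le> norm (diffs a (Suc n) * z ^ Suc n) + norm (\<eta> * (diffs b (Suc n) * z ^ Suc n))"
      by (rule norm_triangle_ineq)
    also have "\<dots> \<le> norm (diffs a (Suc n) * z ^ Suc n) + norm (diffs b (Suc n) * z ^ Suc n)"
      using \<eta>(1) by (subst norm_mult[of \<eta>]) (simp add: mult_left_le_one_le)
    also have "\<dots> = (norm (a (n + 2)) + norm (b (n + 2))) * ?k"
    proof -
      have "norm (diffs x (Suc n) * z ^ Suc n) = norm (x (n + 2)) * ?k" for x :: "nat \<Rightarrow> complex"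
        by (simp only: diffs_def norm_mult norm_power norm_of_nat) (simp add: algebra_simps)
      then show ?thesis
        by (simp only: ring_distribs)
    qed
    also have "\<dots> \<le> c * ?k"
      using bd[of "n + 2"] by (intro mult_right_mono) auto
    finally show "norm (diffs a (Suc n) * z ^ Suc n + \<eta> * (diffs b (Suc n) * z ^ Suc n)) \<le> c * ?k" .
  qed (use z1 in auto)
  moreover have "1 - ?\<beta> \<le> norm (- (1 + \<eta> * b 1))"
  proof -
    have "norm (\<eta> * b 1) \<le> ?\<beta>"
      using \<eta>(1) by (simp add: norm_mult mult_left_le_one_le)
    then show ?thesis
      using norm_diff_ineq[of 1 "\<eta> * b 1"] by (simp only: norm_minus_cancel norm_one)
  qed
  ultimately show False
    using derivative_majorant_less[OF c b1 z] by linarith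
qed

lemma sense_preserving_harmonicI:
  assumes "open S" "h holomorphic_on S" "g holomorphic_on S"
    and "\<And>z. z \<in> S \<Longrightarrow> norm (deriv g z) < norm (deriv h z)"
  shows "sense_preserving_on (\<lambda>z. h z + cnj (g z)) S"
  unfolding sense_preserving_on_def
proof
  fix z assume z: "z \<in> S"
  have "(h has_field_derivative deriv h z) (at z)" "(g has_field_derivative deriv g z) (at z)"
    using assms z by (auto intro: holomorphic_derivI)
  then have "((\<lambda>z. h z + cnj (g z)) has_derivative
      (\<lambda>v. deriv h z * v + cnj (deriv g z * v))) (at z)"
    unfolding has_field_derivative_def
    by (intro has_derivative_add bounded_linear.has_derivative[OF bounded_linear_cnj])
  moreover have "(Re (deriv g z))\<^sup>2 + (Im (deriv g z))\<^sup>2 < (Re (deriv h z))\<^sup>2 + (Im (deriv h z))\<^sup>2"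
    using assms(4)[OF z] unfolding cmod_def by simp
  ultimately show "\<exists>f'. ((\<lambda>z. h z + cnj (g z)) has_derivative f') (at z) \<and>
        Re (f' 1) * Im (f' \<i>) - Im (f' 1) * Re (f' \<i>) > 0"
    by (intro exI[of _ "\<lambda>v. deriv h z * v + cnj (deriv g z * v)"])
      (simp add: power2_eq_square algebra_simps)
qed

section \<open>Starlike images\<close>

text \<open>
  The image is open by invariance of domain, so its trace on the segment from 0 to \<open>f z\<close> is
  relatively open.  By the comparison of moduli this trace is already covered by the image of the
  compact disk of radius \<open>|z|\<close>, so it is relatively closed as well, and the segment is connected.
\<close>

lemma starlike_image_ball:
  fixes f :: "complex \<Rightarrow> complex"
  assumes R: "R > 0" and cont: "continuous_on (ball 0 R) f" and inj: "inj_on f (ball 0 R)"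
    and f0: "f 0 = 0"
    and radial: "\<And>z w \<mu>. \<lbrakk>z \<in> ball 0 R; w \<in> ball 0 R; 0 \<le> \<mu>; \<mu> \<le> 1; f w = of_real \<mu> * f z\<rbrakk>
      \<Longrightarrow> norm w \<le> norm z"
  shows "starlike_domain (f ` ball 0 R)"
proof -
  have op: "open (f ` ball 0 R)"
    using cont inj by (intro invariance_of_domain) auto
  have "closed_segment 0 (f z) \<subseteq> f ` ball 0 R" if z: "z \<in> ball 0 R" for z
  proof -
    let ?I = "closed_segment 0 (f z)"
    have cb: "cball 0 (norm z) \<subseteq> ball 0 R"
      using z by auto
    have eq: "?I \<inter> f ` ball 0 R = ?I \<inter> f ` cball 0 (norm z)"
    proof (intro equalityI subsetI)
      fix x assume "x \<in> ?I \<inter> f ` ball 0 R"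
      then obtain t w where t: "0 \<le> t" "t \<le> 1" "x = of_real t * f z" and w: "w \<in> ball 0 R" "x = f w"
        by (auto simp: in_segment scaleR_conv_of_real)
      then have "norm w \<le> norm z"
        by (intro radial[OF z]) auto
      then show "x \<in> ?I \<inter> f ` cball 0 (norm z)"
        using \<open>x \<in> ?I \<inter> f ` ball 0 R\<close> w by auto
    qed (use cb in auto)
    have "compact (f ` cball 0 (norm z))"
      using cb by (intro compact_continuous_image continuous_on_subset[OF cont]) auto
    then have "closedin (top_of_set ?I) (?I \<inter> f ` ball 0 R)"
      unfolding eq by (intro closedin_closed_Int compact_imp_closed)
    moreover have "openin (top_of_set ?I) (?I \<inter> f ` ball 0 R)"
      by (intro openin_open_Int op)
    moreover have "f z \<in> ?I \<inter> f ` ball 0 R"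
      using z by auto
    ultimately have "?I \<inter> f ` ball 0 R = ?I"
      using connected_segment[of 0 "f z"] unfolding connected_clopen by blast
    then show ?thesis
      by blast
  qed
  moreover have "connected (f ` ball 0 R)"
    by (intro connected_continuous_image cont connected_ball)
  moreover have "0 \<in> f ` ball 0 R"
    using R f0 by (metis centre_in_ball image_eqI)
  ultimately show ?thesis
    using op R by (auto simp: starlike_domain_def planar_domain_def)
qed

text \<open>
  On each ray from 0 the domain cuts out an initial half-open interval.  If this is not the whole
  ray, the remainder is a closed half-line; these half-lines cover the complement, and they are
  disjoint because they lie on different rays.
\<close>

lemma starlike_imp_close_to_convex:
  assumes S: "starlike_domain S"
  shows "close_to_convex_domain S"
proof -
  have op: "open S" and S0: "0 \<in> S"
    using S by (auto simp: starlike_domain_def planar_domain_def)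
  have seg: "of_real s * u \<in> S" if "of_real t * u \<in> S" "0 \<le> s" "s \<le> t" for s t :: real and u :: complex
  proof (cases "t = 0")
    case False
    then have "of_real s * u = (s / t) *\<^sub>R (of_real t * u)"
      by (simp add: scaleR_conv_of_real)
    then have "of_real s * u \<in> closed_segment 0 (of_real t * u)"
      using that False by (auto simp: in_segment intro!: exI[of _ "s / t"])
    then show ?thesis
      using S that(1) by (auto simp: starlike_domain_def)
  qed (use that S0 in auto)
  \<comment> \<open>\<open>T\<close> is the exit time of the ray in direction \<open>u\<close>; the last condition makes it unique.\<close>
  define L where "L = {(of_real T * u, u) |T u. norm u = 1 \<and> 0 \<le> T \<and> of_real T * u \<notin> S \<and>
    (\<forall>t. 0 \<le> t \<and> t < T \<longrightarrow> of_real t * u \<in> S)}"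
  have "\<forall>(p, u) \<in> L. norm u = 1"
    by (auto simp: L_def)
  moreover have "- S = (\<Union>(p, u) \<in> L. closed_half_line p u)"
  proof (intro equalityI subsetI)
    fix x assume "x \<in> - S"
    then have x: "x \<notin> S" "x \<noteq> 0"
      using S0 by auto
    define u where "u = sgn x"
    have u: "norm u = 1" "x = of_real (norm x) * u"
      using x by (simp_all add: u_def norm_sgn) (simp add: sgn_eq)
    define A where "A = {t. 0 \<le> t} \<inter> (\<lambda>t. of_real t * u) -` (- S)"
    have A: "closed A" "norm x \<in> A" "bdd_below A"
      using op u x unfolding A_def bdd_below_def
      by (auto intro!: closed_Int closed_Collect_le continuous_closed_vimage continuous_intros)
    define T where "T = Inf A"
    have "T \<in> A" "T \<le> norm x"
      using A unfolding T_def by (auto intro: closed_contains_Inf cInf_lower)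
    moreover have "of_real t * u \<in> S" if "0 \<le> t" "t < T" for t
      using that A cInf_lower[of t A] by (auto simp: A_def T_def)
    ultimately have "(of_real T * u, u) \<in> L"
      using u unfolding L_def A_def by auto
    moreover have "x \<in> closed_half_line (of_real T * u) u"
      using u \<open>T \<le> norm x\<close> unfolding closed_half_line_def
      by (intro CollectI exI[of _ "norm x - T"]) (simp add: algebra_simps)
    ultimately show "x \<in> (\<Union>(p, u) \<in> L. closed_half_line p u)"
      by blast
  next
    fix x assume "x \<in> (\<Union>(p, u) \<in> L. closed_half_line p u)"
    then obtain T t u where T: "0 \<le> T" "of_real T * u \<notin> S" "0 \<le> t" "x = of_real (T + t) * u"
      by (auto simp: L_def closed_half_line_def algebra_simps)
    then show "x \<in> - S"
      using seg[of "T + t" u T] by auto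
  qed
  moreover have "disjoint_family_on (\<lambda>(p, u). open_half_line p u) L"
  proof -
    have uniq: "p = q \<and> u = v"
      if in_L: "(p, u) \<in> L" "(q, v) \<in> L" and x: "x \<in> open_half_line p u" "x \<in> open_half_line q v" for p q u v x
    proof -
      obtain P Q where P: "p = of_real P * u" "norm u = 1" "0 \<le> P" "of_real P * u \<notin> S"
          "\<forall>t. 0 \<le> t \<and> t < P \<longrightarrow> of_real t * u \<in> S"
        and Q: "q = of_real Q * v" "norm v = 1" "0 \<le> Q" "of_real Q * v \<notin> S"
          "\<forall>t. 0 \<le> t \<and> t < Q \<longrightarrow> of_real t * v \<in> S"
        using in_L unfolding L_def by blast
      obtain s t where st: "s > 0" "t > 0" "x = of_real (P + s) * u" "x = of_real (Q + t) * v"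
        using x P(1) Q(1) by (auto simp: open_half_line_def algebra_simps)
      have nP: "norm x = P + s"
        unfolding st(3) norm_mult norm_of_real using st(1) P(2,3) by simp
      have nQ: "norm x = Q + t"
        unfolding st(4) norm_mult norm_of_real using st(2) Q(2,3) by simp
      have "of_real (norm x) * u = of_real (norm x) * v"
        using st(3,4) unfolding nP[symmetric] nQ[symmetric] by (rule subst)
      moreover have "norm x \<noteq> 0"
        using nP st(1) P(3) by linarith
      ultimately have "u = v"
        by (simp only: mult_cancel_left of_real_eq_0_iff) simp
      moreover have "P = Q"
        using P(3-5) Q(3-5) unfolding \<open>u = v\<close> by (cases P Q rule: linorder_cases) blast+
      ultimately show ?thesis
        using P Q by simp
    qed
    then show ?thesis
      unfolding disjoint_family_on_def by (fast dest: uniq)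
  qed
  ultimately show ?thesis
    using S unfolding close_to_convex_domain_def starlike_domain_def by blast
qed

lemma starlike_in_disk_r_S:
  assumes cb: "coefficient_bounded c h g a b" and c: "c \<ge> 0"
  shows "starlike_in_disk (\<lambda>z. h z + cnj (g z)) (r_S c (norm (b 1)))"
proof -
  let ?R = "r_S c (norm (b 1))" and ?f = "\<lambda>z. h z + cnj (g z)"
  have b1: "norm (b 1) < 1"
    using cb by (simp add: coefficient_bounded_def)
  have sub: "ball 0 ?R \<subseteq> ball (0::complex) 1"
    using r_S_le_1[OF c b1] by auto
  then have hol: "h holomorphic_on ball 0 ?R" "g holomorphic_on ball 0 ?R"
    using cb by (auto simp: coefficient_bounded_def intro: holomorphic_on_subset)
  have rigid: "w = of_real \<mu> * z"
    if "z \<in> ball 0 ?R" "w \<in> ball 0 ?R" "norm z \<le> norm w" "0 \<le> \<mu>" "\<mu> \<le> 1"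
      "?f w = of_real \<mu> * ?f z" for z w \<mu>
    using that by (intro radial_rigidity[OF cb c, of w z]) simp_all
  have inj: "inj_on ?f (ball 0 ?R)"
  proof (rule inj_onI)
    fix z w assume zw: "z \<in> ball 0 ?R" "w \<in> ball 0 ?R" "?f z = ?f w"
    show "z = w"
    proof (cases "norm z \<le> norm w")
      case True
      then have "w = of_real 1 * z"
        using zw by - (rule rigid, simp_all)
      then show ?thesis by simp
    next
      case False
      then have "z = of_real 1 * w"
        using zw by - (rule rigid, simp_all)
      then show ?thesis by simp
    qed
  qed
  have "sense_preserving_on ?f (ball 0 ?R)"
    using hol by (intro sense_preserving_harmonicI analytic_part_dominates[OF cb c])
      (auto intro: holomorphic_derivI)
  moreover have "starlike_domain (?f ` ball 0 ?R)"
  proof (rule starlike_image_ball)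
    show "continuous_on (ball 0 ?R) ?f"
      using hol by (intro continuous_intros holomorphic_on_imp_continuous_on)
    have "(0::complex) \<in> ball 0 1"
      by simp
    then have "(\<lambda>n. a n * 0 ^ n) sums h 0" "(\<lambda>n. b n * 0 ^ n) sums g 0" "a 0 = 0" "b 0 = 0"
      using cb unfolding coefficient_bounded_def by blast+
    then have "h 0 = 0" "g 0 = 0"
      by (simp_all add: powser_sums_zero_iff)
    then show "?f 0 = 0"
      by simp
    show "norm w \<le> norm z"
      if "z \<in> ball 0 ?R" "w \<in> ball 0 ?R" "0 \<le> \<mu>" "\<mu> \<le> 1" "?f w = of_real \<mu> * ?f z" for z w \<mu>
    proof (rule ccontr)
      assume "\<not> norm w \<le> norm z"
      then have "w = of_real \<mu> * z"
        using that by - (rule rigid, simp_all)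
      then have "norm w \<le> norm z"
        using that by (simp add: norm_mult mult_left_le_one_le)
      with \<open>\<not> norm w \<le> norm z\<close> show False ..
    qed
  qed (use inj r_S_pos[OF c b1] in auto)
  ultimately show ?thesis
    using inj by (simp add: starlike_in_disk_def)
qed

section \<open>Sharpness\<close>

text \<open>
  The analytic part is \<open>z - c z\<^sup>2 / (1 - z)\<close>, written in partial fractions: this form splits into a
  linear function and a geometric series, and it makes coincidences of values easy to compute.
\<close>

lemma extremal_coefficient_bounded:
  fixes c \<beta> :: real
  assumes "c \<ge> 0" "0 \<le> \<beta>" "\<beta> < 1"
  shows "coefficient_bounded c (\<lambda>z. of_real (c + 1) * z + of_real c - of_real c / (1 - z))
    (\<lambda>z. - of_real \<beta> * z)
    (\<lambda>n. if n = 0 then 0 else if n = 1 then 1 else - of_real c)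
    (\<lambda>n. if n = 1 then - of_real \<beta> else 0)"
proof -
  have "(\<lambda>n. (if n = 0 then 0 else if n = 1 then 1 else - of_real c) * z ^ n)
      sums (of_real (c + 1) * z + of_real c - of_real c / (1 - z))"
    if "z \<in> ball 0 1" for z :: complex
  proof -
    have "(\<lambda>n. (if n = 1 then of_real (c + 1) * z else 0) + (if n = 0 then of_real c else 0)
        - of_real c * z ^ n)
      sums (of_real (c + 1) * z + of_real c - of_real c * (1 / (1 - z)))"
      using that by (intro sums_diff sums_add sums_mult geometric_sums
          sums_single[of 1 "\<lambda>_. of_real (c + 1) * z"] sums_single[of 0 "\<lambda>_. of_real c"]) auto
    moreover have "(\<lambda>n. (if n = 1 then of_real (c + 1) * z else 0) + (if n = 0 then of_real c else 0)
        - of_real c * z ^ n) = (\<lambda>n. (if n = 0 then 0 else if n = 1 then 1 else - of_real c) * z ^ n)"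
      by (auto simp: fun_eq_iff algebra_simps)
    ultimately show ?thesis
      by simp
  qed
  moreover have "(\<lambda>n. (if n = 1 then - of_real \<beta> else 0) * z ^ n) sums (- of_real \<beta> * z)" for z :: complex
    using sums_single[of 1 "\<lambda>n. - of_real \<beta> * z ^ n"]
    by (simp add: if_distrib[of "\<lambda>x. x * _"] cong: if_cong)
  moreover have "(\<lambda>z::complex. of_real (c + 1) * z + of_real c - of_real c / (1 - z)) holomorphic_on ball 0 1"
    by (intro holomorphic_intros) auto
  moreover have "(\<lambda>z::complex. - of_real \<beta> * z) holomorphic_on ball 0 1"
    by (intro holomorphic_intros)
  ultimately show ?thesis
    using assms by (auto simp: coefficient_bounded_def)
qed

text \<open>
  With \<open>K = c + 1 - \<beta>\<close>, the function is \<open>t \<mapsto> K t + c - c / (1 - t)\<close> on the real axis.  For \<open>x \<noteq> y\<close>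
  the values agree if and only if \<open>(1 - x) (1 - y) = c / K = s\<^sup>2\<close>, where \<open>s = 1 - r_S c \<beta>\<close>.  So one
  point is taken slightly beyond the fold at \<open>1 - s\<close>, and the other is its mirror image.
\<close>

lemma extremal_not_inj:
  fixes c \<beta> r :: real
  assumes c: "c \<ge> 0" and \<beta>: "0 \<le> \<beta>" "\<beta> < 1" and r: "r_S c \<beta> < r" "r \<le> 1"
  shows "\<not> inj_on (\<lambda>z. (of_real (c + 1) * z + of_real c - of_real c / (1 - z)) + cnj (- of_real \<beta> * z))
    (ball 0 r)" (is "\<not> inj_on ?f _")
proof -
  define s where "s = sqrt (c / (c + 1 - \<beta>))"
  \<comment> \<open>For \<open>c = 0\<close> the radius is already 1.\<close>
  have "c \<noteq> 0"
    using r by (auto simp: r_S_def)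
  then have s: "1 - r < s" "s < 1" "s\<^sup>2 * (c + 1 - \<beta>) = c" "0 < s"
    using r r_S_pos[OF c \<beta>(2)] c \<beta> by (auto simp: s_def r_S_def)
  have "s\<^sup>2 < s"
    using s by (simp add: power2_eq_square)
  \<comment> \<open>\<open>p\<close> plays the role of \<open>1 - y\<close>: above \<open>1 - r\<close> so that \<open>y < r\<close>, below \<open>s\<close> so that \<open>y\<close> lies
    beyond the fold, and above \<open>s\<^sup>2\<close> so that the partner \<open>x = 1 - s\<^sup>2 / p\<close> is positive.\<close>
  define p where "p = (s + max (1 - r) (s\<^sup>2)) / 2"
  have p: "1 - r < p" "s\<^sup>2 < p" "p < s"
    using s \<open>s\<^sup>2 < s\<close> by (auto simp: p_def)
  then have p0: "p > 0"
    by (smt (verit) zero_le_power2)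
  define x where "x = 1 - s\<^sup>2 / p"
  define y where "y = 1 - p"
  have "s * p < s\<^sup>2"
    using p s by (simp add: power2_eq_square)
  then have "s < s\<^sup>2 / p" "s\<^sup>2 / p < 1"
    using p p0 by (simp_all add: field_simps)
  then have xy: "0 < x" "x < y" "y < r"
    using p unfolding x_def y_def by auto
  have val: "?f (of_real t) = of_real ((c + 1 - \<beta>) * t + c - c / (1 - t))" for t :: real
    by (simp add: algebra_simps)
  have "(c + 1 - \<beta>) * x + c - c / (1 - x) = (c + 1 - \<beta>) * y + c - c / (1 - y)"
  proof -
    define K where "K = c + 1 - \<beta>"
    have cK: "c = K * s\<^sup>2"
      using s by (simp add: K_def mult.commute)
    have "c / (1 - x) = K * p" "c / (1 - y) = K * (s\<^sup>2 / p)"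
      using s p0 by (subst cK, simp add: x_def y_def)+
    then show ?thesis
      unfolding K_def[symmetric] by (simp only: x_def y_def) (simp add: algebra_simps)
  qed
  then have "?f (of_real x) = ?f (of_real y)"
    by (simp only: val)
  moreover have "complex_of_real x \<in> ball 0 r" "complex_of_real y \<in> ball 0 r"
    using xy by auto
  moreover have "complex_of_real x \<noteq> of_real y"
    using xy by simp
  ultimately show ?thesis
    by (meson inj_onD)
qed

theorem theorem1p11:
  fixes c :: real
  assumes "c \<ge> 0"
  shows "(\<forall>h g a b. coefficient_bounded c h g a b \<longrightarrow>
            close_to_convex_in_disk (\<lambda>z. h z + cnj (g z)) (r_S c (norm (b 1))) \<and>
            starlike_in_disk (\<lambda>z. h z + cnj (g z)) (r_S c (norm (b 1)))) \<and>
         (\<forall>\<beta> r. 0 \<le> \<beta> \<and> \<beta> < 1 \<and> r_S c \<beta> < r \<and> r \<le> 1 \<longrightarrow>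
            (\<exists>h g a b. coefficient_bounded c h g a b \<and> norm (b 1) = \<beta> \<and>
               \<not> inj_on (\<lambda>z. h z + cnj (g z)) (ball 0 r)))"
proof (intro conjI allI impI)
  fix h g a b assume "coefficient_bounded c h g a b"
  then show st: "starlike_in_disk (\<lambda>z. h z + cnj (g z)) (r_S c (norm (b 1)))"
    using assms by (rule starlike_in_disk_r_S)
  then show "close_to_convex_in_disk (\<lambda>z. h z + cnj (g z)) (r_S c (norm (b 1)))"
    by (auto simp: starlike_in_disk_def close_to_convex_in_disk_def
        intro: starlike_imp_close_to_convex)
next
  fix \<beta> r assume "0 \<le> \<beta> \<and> \<beta> < 1 \<and> r_S c \<beta> < r \<and> r \<le> 1"
  then have \<beta>: "0 \<le> \<beta>" "\<beta> < 1" and r: "r_S c \<beta> < r" "r \<le> 1"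
    by auto
  show "\<exists>h g a b. coefficient_bounded c h g a b \<and> norm (b 1) = \<beta> \<and>
               \<not> inj_on (\<lambda>z. h z + cnj (g z)) (ball 0 r)"
  proof -
    define b where "b n = (if n = 1 then - of_real \<beta> else 0 :: complex)" for n :: nat
    have "norm (b 1) = \<beta>"
      using \<beta>(1) by (simp add: b_def)
    with extremal_coefficient_bounded[OF assms \<beta>, folded b_def] extremal_not_inj[OF assms \<beta> r]
    show ?thesis
      by blast
  qed
qed

end
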